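(* Let $E$ and $F$ be Hilbert $C^*$-modules over $C^*$-algebras $\mathcal B$ and $\mathcal C$ respectively, let $S$ be a set, and let $\vartheta:B^a(E)\to B^a(F)$ be a CPDH$_0$-quasi-dilation of a CPD-kernel $\mathfrak K:S\times S\to B(\mathcal B,\mathcal C)$. If $\{\mathcal K^\sigma\}_{\sigma\in S}$ is a family of maps from $E$ to $F$ such that $$\langle\mathcal K^\sigma(x),\vartheta(a)\mathcal K^{\sigma'}(x')\rangle=\mathfrak K^{\sigma,\sigma'}(\langle x,ax'\rangle)\quad\text{for all }x,x'\in E,\ a\in B^a(E),\ \sigma,\sigma'\in S,$$ then $\{\mathcal K^\sigma\}_{\sigma\in S}$ is a $\mathfrak K$-family and $$\mathcal K^\sigma(ax)=\vartheta(a)\mathcal K^\sigma(x)\quad\text{for all }x\in E,\ a\in B^a(E),\ \sigma\in S.$$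
   Context: Inner products on Hilbert $C^*$-modules are linear in the second variable. $B(\mathcal B,\mathcal C)$ is the set of bounded linear maps; $B^a(E)$ the algebra of adjointable operators on $E$. A kernel $\mathfrak K:S\times S\to B(\mathcal B,\mathcal C)$ is a CPD-kernel if $\sum_{i,j}c_i^*\mathfrak K^{\sigma_i,\sigma_j}(b_i^*b_j)c_j\ge0$ for all finite choices of $\sigma_i\in S$, $b_i\in\mathcal B$, $c_i\in\mathcal C$. A family $\{\mathcal K^\sigma\}_{\sigma\in S}$ of maps from $E$ to $F$ is a $\mathfrak K$-family if $\langle\mathcal K^\sigma(x),\mathcal K^{\sigma'}(x')\rangle=\mathfrak K^{\sigma,\sigma'}(\langle x,x'\rangle)$ for all $x,x'\in E$, $\sigma,\sigma'\in S$. A $*$-homomorphism $\vartheta:B^a(E)\to B^a(F)$ is a CPDH-quasi-dilation of $\mathfrak K$ if there are linear maps $\mathcal K^\sigma:E\to F$ ($\sigma\in S$) with $\langle\mathcal K^\sigma(x),\vartheta(a)\mathcal K^{\sigma'}(x')\rangle=\mathfrak K^{\sigma,\sigma'}(\langle x,ax'\rangle)$ for all $x,x'\in E$, $a\in B^a(E)$, $\sigma,\sigma'\in S$ ($E$ need not be full). It is a CPDH$_0$-quasi-dilation if moreover $\vartheta$ is unital. *)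

theory Defs
  imports "HOL-Analysis.Analysis"
begin

class complex_vector = real_vector +
  fixes scaleC :: "complex \<Rightarrow> 'a \<Rightarrow> 'a"  (infixr "*\<^sub>C" 75)
  assumes scaleC_add_right: "c *\<^sub>C (x + y) = c *\<^sub>C x + c *\<^sub>C y"
    and scaleC_add_left: "(c + d) *\<^sub>C x = c *\<^sub>C x + d *\<^sub>C x"
    and scaleC_scaleC: "c *\<^sub>C (d *\<^sub>C x) = (c * d) *\<^sub>C x"
    and scaleC_one: "1 *\<^sub>C x = x"
    and scaleR_scaleC: "r *\<^sub>R x = complex_of_real r *\<^sub>C x"

class complex_banach = complex_vector + banach +
  assumes norm_scaleC: "norm (c *\<^sub>C x) = cmod c * norm x"

text \<open>C*-algebras are not assumed to be unital.\<close>

class cstar_algebra = complex_banach + real_normed_algebra +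
  fixes star :: "'a \<Rightarrow> 'a"
  assumes scaleC_mult_left: "(c *\<^sub>C x) * y = c *\<^sub>C (x * y)"
    and scaleC_mult_right: "x * (c *\<^sub>C y) = c *\<^sub>C (x * y)"
    and star_add: "star (x + y) = star x + star y"
    and star_scaleC: "star (c *\<^sub>C x) = cnj c *\<^sub>C star x"
    and star_mult: "star (x * y) = star y * star x"
    and star_star: "star (star x) = x"
    and norm_star_mult_self: "norm (star x * x) = (norm x)\<^sup>2"

definition cstar_nonneg :: "'a::cstar_algebra \<Rightarrow> bool" where
  "cstar_nonneg a \<longleftrightarrow> (\<exists>d. a = star d * d)"

definition clinear :: "('a::complex_vector \<Rightarrow> 'b::complex_vector) \<Rightarrow> bool" where
  "clinear T \<longleftrightarrow> (\<forall>x y. T (x + y) = T x + T y) \<and> (\<forall>c x. T (c *\<^sub>C x) = c *\<^sub>C T x)"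

definition bounded_clinear :: "('a::complex_banach \<Rightarrow> 'b::complex_banach) \<Rightarrow> bool" where
  "bounded_clinear T \<longleftrightarrow> clinear T \<and> (\<exists>M. \<forall>x. norm (T x) \<le> M * norm x)"

text \<open>
  A (right) Hilbert module whose elements form the type \<open>'e\<close>, with right action \<open>act\<close>
  and inner product \<open>ip\<close>, linear in the second variable. Completeness with respect to the
  norm coming from the inner product is the combination of \<open>norm_ip\<close> with the class
  \<open>banach\<close> of \<open>'e\<close>.
\<close>

locale hilbert_module =
  fixes act :: "'e::complex_banach \<Rightarrow> 'b::cstar_algebra \<Rightarrow> 'e"
    and ip :: "'e \<Rightarrow> 'e \<Rightarrow> 'b"
  assumes act_add_left: "act (x + y) b = act x b + act y b"
    and act_add_right: "act x (b + b') = act x b + act x b'"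
    and act_mult: "act x (b * b') = act (act x b) b'"
    and act_scaleC_left: "act (c *\<^sub>C x) b = c *\<^sub>C act x b"
    and act_scaleC_right: "act x (c *\<^sub>C b) = c *\<^sub>C act x b"
    and ip_add_right: "ip x (y + z) = ip x y + ip x z"
    and ip_scaleC_right: "ip x (c *\<^sub>C y) = c *\<^sub>C ip x y"
    and ip_act_right: "ip x (act y b) = ip x y * b"
    and ip_star: "star (ip x y) = ip y x"
    and ip_self_nonneg: "cstar_nonneg (ip x x)"
    and ip_self_eq_0: "ip x x = 0 \<Longrightarrow> x = 0"
    and norm_ip: "norm x = sqrt (norm (ip x x))"

definition is_module_adjoint ::
    "('e \<Rightarrow> 'e \<Rightarrow> 'b) \<Rightarrow> ('e \<Rightarrow> 'e) \<Rightarrow> ('e \<Rightarrow> 'e) \<Rightarrow> bool" where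
  "is_module_adjoint ip a a' \<longleftrightarrow> (\<forall>x y. ip (a x) y = ip x (a' y))"

text \<open>The carrier of \<open>B\<^sup>a(E)\<close>; adjointable maps are automatically linear and bounded.\<close>

definition adjointables :: "('e \<Rightarrow> 'e \<Rightarrow> 'b) \<Rightarrow> ('e \<Rightarrow> 'e) set" where
  "adjointables ip = {a. \<exists>a'. is_module_adjoint ip a a'}"

definition module_adjoint :: "('e \<Rightarrow> 'e \<Rightarrow> 'b) \<Rightarrow> ('e \<Rightarrow> 'e) \<Rightarrow> 'e \<Rightarrow> 'e" where
  "module_adjoint ip a = (THE a'. is_module_adjoint ip a a')"

lemma (in hilbert_module) module_adjoint_eq:
  assumes "is_module_adjoint ip a a'"
  shows "module_adjoint ip a = a'"
  unfolding module_adjoint_def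
proof (rule the_equality)
  show "is_module_adjoint ip a a'"
    by (rule assms)
next
  fix a'' assume a'': "is_module_adjoint ip a a''"
  show "a'' = a'"
  proof
    fix y
    have "ip z (a'' y) = ip z (a' y)" for z
      using assms a'' unfolding is_module_adjoint_def by metis
    then have "ip z (a'' y - a' y) = 0" for z
      using ip_add_right[of z "a'' y - a' y" "a' y"] by simp
    then show "a'' y = a' y"
      using ip_self_eq_0 by fastforce
  qed
qed

text \<open>
  A *-homomorphism from \<open>B\<^sup>a(E)\<close> to \<open>B\<^sup>a(F)\<close> is represented by a total function on maps of
  which only the restriction to \<open>adjointables ipE\<close> matters.
\<close>

definition star_hom_adjointables ::
    "('e::complex_banach \<Rightarrow> 'e \<Rightarrow> 'b::cstar_algebra) \<Rightarrow> ('f::complex_banach \<Rightarrow> 'f \<Rightarrow> 'c::cstar_algebra)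
      \<Rightarrow> (('e \<Rightarrow> 'e) \<Rightarrow> ('f \<Rightarrow> 'f)) \<Rightarrow> bool" where
  "star_hom_adjointables ipE ipF \<theta> \<longleftrightarrow>
     (\<forall>a\<in>adjointables ipE. \<theta> a \<in> adjointables ipF) \<and>
     (\<forall>a\<in>adjointables ipE. \<forall>b\<in>adjointables ipE.
        \<theta> (\<lambda>x. a x + b x) = (\<lambda>y. \<theta> a y + \<theta> b y)) \<and>
     (\<forall>c. \<forall>a\<in>adjointables ipE. \<theta> (\<lambda>x. c *\<^sub>C a x) = (\<lambda>y. c *\<^sub>C \<theta> a y)) \<and>
     (\<forall>a\<in>adjointables ipE. \<forall>b\<in>adjointables ipE. \<theta> (a \<circ> b) = \<theta> a \<circ> \<theta> b) \<and>
     (\<forall>a\<in>adjointables ipE. \<theta> (module_adjoint ipE a) = module_adjoint ipF (\<theta> a))"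

definition cpd_kernel ::
    "'s set \<Rightarrow> ('s \<Rightarrow> 's \<Rightarrow> 'b::cstar_algebra \<Rightarrow> 'c::cstar_algebra) \<Rightarrow> bool" where
  "cpd_kernel S \<KK> \<longleftrightarrow>
     (\<forall>\<sigma>\<in>S. \<forall>\<sigma>'\<in>S. bounded_clinear (\<KK> \<sigma> \<sigma>')) \<and>
     (\<forall>(n::nat) \<sigma> b c. (\<forall>i<n. \<sigma> i \<in> S) \<longrightarrow>
        cstar_nonneg (\<Sum>i<n. \<Sum>j<n. star (c i) * \<KK> (\<sigma> i) (\<sigma> j) (star (b i) * b j) * c j))"

text \<open>The members of a family are arbitrary maps, not assumed to be linear.\<close>

definition kernel_family ::
    "('e \<Rightarrow> 'e \<Rightarrow> 'b) \<Rightarrow> ('f \<Rightarrow> 'f \<Rightarrow> 'c) \<Rightarrow> 's set \<Rightarrow> ('s \<Rightarrow> 's \<Rightarrow> 'b \<Rightarrow> 'c)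
      \<Rightarrow> ('s \<Rightarrow> 'e \<Rightarrow> 'f) \<Rightarrow> bool" where
  "kernel_family ipE ipF S \<KK> K \<longleftrightarrow>
     (\<forall>\<sigma>\<in>S. \<forall>\<sigma>'\<in>S. \<forall>x x'. ipF (K \<sigma> x) (K \<sigma>' x') = \<KK> \<sigma> \<sigma>' (ipE x x'))"

definition cpdh_quasi_dilation ::
    "('e::complex_banach \<Rightarrow> 'e \<Rightarrow> 'b::cstar_algebra) \<Rightarrow> ('f::complex_banach \<Rightarrow> 'f \<Rightarrow> 'c::cstar_algebra)
      \<Rightarrow> 's set \<Rightarrow> ('s \<Rightarrow> 's \<Rightarrow> 'b \<Rightarrow> 'c) \<Rightarrow> (('e \<Rightarrow> 'e) \<Rightarrow> ('f \<Rightarrow> 'f)) \<Rightarrow> bool" where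
  "cpdh_quasi_dilation ipE ipF S \<KK> \<theta> \<longleftrightarrow>
     star_hom_adjointables ipE ipF \<theta> \<and>
     (\<exists>K :: 's \<Rightarrow> 'e \<Rightarrow> 'f. (\<forall>\<sigma>\<in>S. clinear (K \<sigma>)) \<and>
        (\<forall>\<sigma>\<in>S. \<forall>\<sigma>'\<in>S. \<forall>x x'. \<forall>a\<in>adjointables ipE.
           ipF (K \<sigma> x) (\<theta> a (K \<sigma>' x')) = \<KK> \<sigma> \<sigma>' (ipE x (a x'))))"

definition cpdh0_quasi_dilation ::
    "('e::complex_banach \<Rightarrow> 'e \<Rightarrow> 'b::cstar_algebra) \<Rightarrow> ('f::complex_banach \<Rightarrow> 'f \<Rightarrow> 'c::cstar_algebra)
      \<Rightarrow> 's set \<Rightarrow> ('s \<Rightarrow> 's \<Rightarrow> 'b \<Rightarrow> 'c) \<Rightarrow> (('e \<Rightarrow> 'e) \<Rightarrow> ('f \<Rightarrow> 'f)) \<Rightarrow> bool" where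
  "cpdh0_quasi_dilation ipE ipF S \<KK> \<theta> \<longleftrightarrow>
     cpdh_quasi_dilation ipE ipF S \<KK> \<theta> \<and> \<theta> id = id"

end

theory Submission imports Defs begin

text \<open>
  Since \<open>\<theta>\<close> is a unital *-homomorphism, the four inner products among \<open>u = K \<sigma> (a x)\<close> and
  \<open>v = \<theta> a (K \<sigma> x)\<close> all equal \<open>\<KK> \<sigma> \<sigma> (ipE (a x) (a x))\<close>; hence \<open>u - v\<close> has length zero.
\<close>

lemma star_zero [simp]: "star (0 :: 'a::cstar_algebra) = 0"
  using star_add[of "0 :: 'a" 0] by simp

context hilbert_module
begin

lemma ip_diff_right: "ip x (y - z) = ip x y - ip x z"
  using ip_add_right[of x "y - z" z] by (simp add: eq_diff_eq)

lemma ip_eq_0_commute: "ip x y = 0 \<longleftrightarrow> ip y x = 0"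
  by (metis ip_star star_zero)

text \<open>The hypotheses say that \<open>u - v\<close> is orthogonal to \<open>u\<close> and to
  \<open>v\<close>. Conjugate symmetry moves \<open>u - v\<close> into the first slot, so additivity
  in the second variable makes it orthogonal to itself, and definiteness gives zero.\<close>

lemma eq_if_ip_eq:
  assumes "ip u v = ip u u" and "ip v u = ip v v"
  shows "u = v"
proof -
  have "ip u (u - v) = 0" and "ip v (u - v) = 0"
    using assms by (simp_all add: ip_diff_right)
  then have "ip (u - v) u = 0" and "ip (u - v) v = 0"
    by (simp_all add: ip_eq_0_commute[of "u - v"])
  then have "ip (u - v) (u - v) = 0"
    by (simp add: ip_diff_right)
  then show ?thesis
    using ip_self_eq_0 by fastforce
qed

lemma is_module_adjoint_sym:
  assumes "is_module_adjoint ip a a'"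
  shows "is_module_adjoint ip a' a"
  using assms unfolding is_module_adjoint_def by (metis ip_star)

text \<open>The definite description denotes an actual adjoint because adjoints are unique, by
  \<open>module_adjoint_eq\<close>.\<close>

lemma is_module_adjoint_module_adjoint:
  assumes "a \<in> adjointables ip"
  shows "is_module_adjoint ip a (module_adjoint ip a)"
  using assms module_adjoint_eq unfolding adjointables_def by auto

lemma module_adjoint_in_adjointables:
  assumes "a \<in> adjointables ip"
  shows "module_adjoint ip a \<in> adjointables ip"
  using is_module_adjoint_sym[OF is_module_adjoint_module_adjoint[OF assms]]
  unfolding adjointables_def by auto

lemma id_in_adjointables: "id \<in> adjointables ip"
  unfolding adjointables_def is_module_adjoint_def by auto

lemma comp_in_adjointables:
  assumes "a \<in> adjointables ip" and "b \<in> adjointables ip"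
  shows "a \<circ> b \<in> adjointables ip"
proof -
  from assms obtain a' b' where "is_module_adjoint ip a a'" and "is_module_adjoint ip b b'"
    unfolding adjointables_def by auto
  then have "is_module_adjoint ip (a \<circ> b) (b' \<circ> a')"
    unfolding is_module_adjoint_def by simp
  then show ?thesis
    unfolding adjointables_def by auto
qed

end

theorem proposition4p2:
  fixes actE :: "'e::complex_banach \<Rightarrow> 'b::cstar_algebra \<Rightarrow> 'e"
    and ipE :: "'e \<Rightarrow> 'e \<Rightarrow> 'b"
    and actF :: "'f::complex_banach \<Rightarrow> 'c::cstar_algebra \<Rightarrow> 'f"
    and ipF :: "'f \<Rightarrow> 'f \<Rightarrow> 'c"
    and S :: "'s set"
    and \<KK> :: "'s \<Rightarrow> 's \<Rightarrow> 'b \<Rightarrow> 'c"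
    and \<theta> :: "('e \<Rightarrow> 'e) \<Rightarrow> ('f \<Rightarrow> 'f)"
    and K :: "'s \<Rightarrow> 'e \<Rightarrow> 'f"
  assumes "hilbert_module actE ipE"
    and "hilbert_module actF ipF"
    and "cpd_kernel S \<KK>"
    and "cpdh0_quasi_dilation ipE ipF S \<KK> \<theta>"
    and "\<And>\<sigma> \<sigma>' x x' a. \<sigma> \<in> S \<Longrightarrow> \<sigma>' \<in> S \<Longrightarrow> a \<in> adjointables ipE \<Longrightarrow>
           ipF (K \<sigma> x) (\<theta> a (K \<sigma>' x')) = \<KK> \<sigma> \<sigma>' (ipE x (a x'))"
  shows "kernel_family ipE ipF S \<KK> K \<and>
         (\<forall>\<sigma>\<in>S. \<forall>a\<in>adjointables ipE. \<forall>x. K \<sigma> (a x) = \<theta> a (K \<sigma> x))"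
proof -
  interpret E: hilbert_module actE ipE by fact
  interpret F: hilbert_module actF ipF by fact
  note dil = assms(5)
  have hom: "star_hom_adjointables ipE ipF \<theta>" and unital: "\<theta> id = id"
    using assms(4) unfolding cpdh0_quasi_dilation_def cpdh_quasi_dilation_def by auto
  have family: "ipF (K \<sigma> x) (K \<sigma>' x') = \<KK> \<sigma> \<sigma>' (ipE x x')"
    if "\<sigma> \<in> S" "\<sigma>' \<in> S" for \<sigma> \<sigma>' x x'
    \<comment> \<open>Unitality enters here: taking \<open>a = id\<close> in the dilation identity
      erases \<open>\<theta>\<close>.\<close>
    using dil[OF that E.id_in_adjointables] by (simp add: unital)
  have "K \<sigma> (a x) = \<theta> a (K \<sigma> x)" if \<sigma>: "\<sigma> \<in> S" and a: "a \<in> adjointables ipE" for \<sigma> a x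
  proof -
    define a' where "a' = module_adjoint ipE a"
    have adj: "ipE (a y) z = ipE y (a' z)" for y z
      using E.is_module_adjoint_module_adjoint[OF a]
      unfolding a'_def is_module_adjoint_def by blast
    have a': "a' \<in> adjointables ipE"
      unfolding a'_def by (rule E.module_adjoint_in_adjointables[OF a])
    \<comment> \<open>Since \<open>\<theta>\<close> preserves adjoints, \<open>\<theta> a\<close>
      can be moved across the inner product of \<open>F\<close> as
      \<open>\<theta> a'\<close>.\<close>
    have "\<theta> a \<in> adjointables ipF" and "\<theta> a' = module_adjoint ipF (\<theta> a)"
      using hom a unfolding star_hom_adjointables_def a'_def by auto
    then have adj_\<theta>: "ipF (\<theta> a y) z = ipF y (\<theta> a' z)" for y z
      using F.is_module_adjoint_module_adjoint[of "\<theta> a"] unfolding is_module_adjoint_def by simp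
    have \<theta>_comp: "\<theta> (a' \<circ> a) = \<theta> a' \<circ> \<theta> a"
      using hom a a' unfolding star_hom_adjointables_def by blast
    let ?p = "\<KK> \<sigma> \<sigma> (ipE (a x) (a x))"
    have uu: "ipF (K \<sigma> (a x)) (K \<sigma> (a x)) = ?p"
      by (rule family[OF \<sigma> \<sigma>])
    have uv: "ipF (K \<sigma> (a x)) (\<theta> a (K \<sigma> x)) = ?p"
      by (rule dil[OF \<sigma> \<sigma> a])
    \<comment> \<open>Moving \<open>\<theta> a\<close> to the right leaves the dilation identity for
      \<open>a'\<close> at the points \<open>x\<close> and \<open>a x\<close>; both sides reduce to
      the kernel at \<open>ipE x (a' (a x))\<close>.\<close>
    have vu: "ipF (\<theta> a (K \<sigma> x)) (K \<sigma> (a x)) = ?p"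
      by (simp add: adj_\<theta> dil[OF \<sigma> \<sigma> a'] adj)
    \<comment> \<open>Here the operators combine to \<open>\<theta> a' \<circ> \<theta> a\<close>,
      which is \<open>\<theta> (a' \<circ> a)\<close> by multiplicativity, so the dilation identity
      for \<open>a' \<circ> a\<close> applies.\<close>
    have vv: "ipF (\<theta> a (K \<sigma> x)) (\<theta> a (K \<sigma> x)) = ?p"
      using dil[OF \<sigma> \<sigma> E.comp_in_adjointables[OF a' a], of x x]
      by (simp add: \<theta>_comp adj_\<theta> adj)
    show ?thesis
      by (rule F.eq_if_ip_eq) (simp_all only: uu uv vu vv)
  qed
  with family show ?thesis
    unfolding kernel_family_def by blast
qed

end
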